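(* Let $r=1$ and suppose that the function $f_a:\mathbb{R}^{n\times m}\to\mathbb{R}$ satisfies the $\delta$-RIP$_{2,2}$ property with $\delta<1/2$. Then neither the factorized problem $\min_{U\in\mathbb{R}^{n\times 1},V\in\mathbb{R}^{m\times 1}}f_a(UV^T)$ nor the regularized problem $\min_{U\in\mathbb{R}^{n\times 1},V\in\mathbb{R}^{m\times 1}}f_a(UV^T)+\frac{\mu}{4}\|U^TU-V^TV\|_F^2$ (with $\mu>0$) has a spurious second-order critical point.
   Context: $f_a$ is twice continuously differentiable. Standing assumption: $f_a$ has a first-order critical point $M_a^*$ (i.e. $\nabla f_a(M_a^* )=0$) with $\mathrm{rank}(M_a^* )\le r=1$. $\delta$-RIP$_{2,2}$ (with $\delta\in[0,1)$): $(1-\delta)\|K\|_F^2\le[\nabla^2f_a(M)](K,K)\le(1+\delta)\|K\|_F^2$ for all $M,K\in\mathbb{R}^{n\times m}$ with $\mathrm{rank}(M)\le2$, $\mathrm{rank}(K)\le2$. A second-order critical point of an unconstrained problem is a point where the gradient of the objective vanishes and its Hessian is positive semidefinite; it is spurious if it is not a global minimizer of the problem. *)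

theory Defs
  imports "HOL-Analysis.Analysis"
begin

text \<open>
  The first and second derivatives are taken as bounded linear maps; continuity of the second
  derivative is with respect to the operator norm.
\<close>

definition twice_continuously_differentiable :: "('a::real_normed_vector \<Rightarrow> real) \<Rightarrow> bool" where
  "twice_continuously_differentiable f \<longleftrightarrow>
    (\<exists>(f' :: 'a \<Rightarrow> 'a \<Rightarrow>\<^sub>L real) (f'' :: 'a \<Rightarrow> 'a \<Rightarrow>\<^sub>L 'a \<Rightarrow>\<^sub>L real).
      (\<forall>x. (f has_derivative blinfun_apply (f' x)) (at x)) \<and>
      (\<forall>x. (f' has_derivative blinfun_apply (f'' x)) (at x)) \<and>
      continuous_on UNIV f'')"

text \<open>
  The bilinear form \<open>[\<nabla>\<^sup>2f(x)](h, k)\<close>, as an iterated directional derivative. It is meaningful at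
  points where \<open>f\<close> is twice differentiable, see \<open>hessian_eq_second_derivative\<close> below.
\<close>

definition hessian :: "('a::real_normed_vector \<Rightarrow> real) \<Rightarrow> 'a \<Rightarrow> 'a \<Rightarrow> 'a \<Rightarrow> real" where
  "hessian f x h k =
    frechet_derivative (\<lambda>y. frechet_derivative f (at y) h) (at x) k"

lemma hessian_eq_second_derivative:
  fixes f :: "'a::real_normed_vector \<Rightarrow> real"
    and f' :: "'a \<Rightarrow> 'a \<Rightarrow>\<^sub>L real" and f'' :: "'a \<Rightarrow>\<^sub>L 'a \<Rightarrow>\<^sub>L real"
  assumes "\<And>y. (f has_derivative blinfun_apply (f' y)) (at y)"
    and "(f' has_derivative blinfun_apply f'') (at x)"
  shows "hessian f x h k = blinfun_apply (blinfun_apply f'' k) h"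
proof -
  have "(\<lambda>y. frechet_derivative f (at y) h) = (\<lambda>y. blinfun_apply (f' y) h)"
    using frechet_derivative_at[OF assms(1)] by auto
  moreover have "((\<lambda>y. blinfun_apply (f' y) h) has_derivative
      (\<lambda>k. blinfun_apply (blinfun_apply f'' k) h)) (at x)"
    by (rule bounded_linear.has_derivative[OF blinfun.bounded_linear_left assms(2)])
  ultimately show ?thesis
    unfolding hessian_def using frechet_derivative_at by metis
qed

definition first_order_critical_point :: "('a::real_inner \<Rightarrow> real) \<Rightarrow> 'a \<Rightarrow> bool" where
  "first_order_critical_point f x \<longleftrightarrow> GDERIV f x :> 0"

definition second_order_critical_point :: "('a::real_inner \<Rightarrow> real) \<Rightarrow> 'a \<Rightarrow> bool" where
  "second_order_critical_point f x \<longleftrightarrow>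
    GDERIV f x :> 0 \<and> (\<forall>h. hessian f x h h \<ge> 0)"

definition spurious_second_order_critical_point :: "('a::real_inner \<Rightarrow> real) \<Rightarrow> 'a \<Rightarrow> bool" where
  "spurious_second_order_critical_point f x \<longleftrightarrow>
    second_order_critical_point f x \<and> \<not> is_arg_min f (\<lambda>_. True) x"

text \<open>
  The \<open>\<delta>\<close>-RIP property with rank bounds \<open>p\<close> (base point) and \<open>q\<close> (direction). The norm on
  \<^typ>\<open>real^'m^'n\<close> is the Frobenius norm.
\<close>

definition RIP :: "nat \<Rightarrow> nat \<Rightarrow> real \<Rightarrow> (real^'m^'n \<Rightarrow> real) \<Rightarrow> bool" where
  "RIP p q \<delta> f \<longleftrightarrow> 0 \<le> \<delta> \<and> \<delta> < 1 \<and>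
    (\<forall>M K. rank M \<le> p \<longrightarrow> rank K \<le> q \<longrightarrow>
      (1 - \<delta>) * (norm K)\<^sup>2 \<le> hessian f M K K \<and>
      hessian f M K K \<le> (1 + \<delta>) * (norm K)\<^sup>2)"

definition factorized_objective ::
    "(real^'m^'n \<Rightarrow> real) \<Rightarrow> (real^'r^'n) \<times> (real^'r^'m) \<Rightarrow> real" where
  "factorized_objective f = (\<lambda>(U, V). f (U ** transpose V))"

definition regularized_objective ::
    "real \<Rightarrow> (real^'m^'n \<Rightarrow> real) \<Rightarrow> (real^'r^'n) \<times> (real^'r^'m) \<Rightarrow> real" where
  "regularized_objective \<mu> f = (\<lambda>(U, V).
    f (U ** transpose V) + \<mu> / 4 * (norm (transpose U ** U - transpose V ** V))\<^sup>2)"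

end

theory Submission
  imports Defs
begin

text \<open>
  Let \<open>M = UV\<^sup>T\<close> come from a second-order critical point, let \<open>M* = AB\<^sup>T\<close>, \<open>E = M - M*\<close>, and let \<open>G\<close> be the
  gradient of \<open>f\<close> at \<open>M\<close>. First-order criticality forces \<open>\<parallel>U\<parallel> = \<parallel>V\<parallel>\<close> in the regularized problem, so in
  both problems \<open>GV = 0\<close> and \<open>G\<^sup>TU = 0\<close>. Second-order criticality in directions orthogonal to \<open>U\<close> and \<open>V\<close>
  bounds \<open>-G\<close> on such pairs by \<open>(1 + \<delta>) \<parallel>M\<parallel>\<close>. On the other hand, the RIP along the segment from \<open>M*\<close> to \<open>M\<close>
  shows that \<open>G\<close>, projected to the products of \<open>span(U, A)\<close> and \<open>span(V, B)\<close>, differs from \<open>E\<close> by at most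
  \<open>\<delta> \<parallel>E\<parallel>\<close>. For \<open>\<delta> < 1/2\<close> these bounds are compatible only if \<open>E = 0\<close>.
\<close>

section \<open>Symmetry of continuous second derivatives\<close>

text \<open>Mean value theorem twice: first along \<open>h\<close> for the difference of
  \<open>f\<close> between two parallel segments, then along \<open>k\<close> for \<open>f'\<close>
  applied to \<open>h\<close>. The distance bound on \<open>y\<close> lets \<open>s\<close> shrink
  \<open>y\<close> towards \<open>x\<close>.\<close>

lemma second_difference_mean_value:
  fixes f :: "'a::real_normed_vector \<Rightarrow> real"
    and f' :: "'a \<Rightarrow> 'a \<Rightarrow>\<^sub>L real" and f'' :: "'a \<Rightarrow> 'a \<Rightarrow>\<^sub>L 'a \<Rightarrow>\<^sub>L real"
  assumes f': "\<And>x. (f has_derivative blinfun_apply (f' x)) (at x)"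
    and f'': "\<And>x. (f' has_derivative blinfun_apply (f'' x)) (at x)"
    and s: "s > 0"
  obtains y where "norm (y - x) \<le> s * (norm h + norm k)"
    and "f (x + s *\<^sub>R h + s *\<^sub>R k) - f (x + s *\<^sub>R h) - f (x + s *\<^sub>R k) + f x = s\<^sup>2 * f'' y k h"
proof -
  define \<phi> where "\<phi> t = f (x + t *\<^sub>R h + s *\<^sub>R k) - f (x + t *\<^sub>R h)" for t
  have "(\<phi> has_derivative (\<lambda>d. f' (x + t *\<^sub>R h + s *\<^sub>R k) (d *\<^sub>R h) - f' (x + t *\<^sub>R h) (d *\<^sub>R h))) (at t within {0..s})" for t
    unfolding \<phi>_def
    by (rule has_derivative_diff; rule has_derivative_compose[OF _ f'];
        auto intro!: derivative_eq_intros)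
  then obtain t where t: "t \<in> {0<..<s}" and 1: "\<phi> s - \<phi> 0 =
      f' (x + t *\<^sub>R h + s *\<^sub>R k) (s *\<^sub>R h) - f' (x + t *\<^sub>R h) (s *\<^sub>R h)"
    using mvt_simple[OF s, of \<phi> "\<lambda>t d. f' (x + t *\<^sub>R h + s *\<^sub>R k) (d *\<^sub>R h) - f' (x + t *\<^sub>R h) (d *\<^sub>R h)"]
    by auto
  define \<psi> where "\<psi> r = f' (x + t *\<^sub>R h + r *\<^sub>R k) h" for r
  have "(\<psi> has_derivative (\<lambda>d. f'' (x + t *\<^sub>R h + r *\<^sub>R k) (d *\<^sub>R k) h)) (at r within {0..s})" for r
    unfolding \<psi>_def
    by (rule bounded_linear.has_derivative[OF blinfun.bounded_linear_left], rule has_derivative_compose[OF _ f''])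
       (auto intro!: derivative_eq_intros)
  then obtain r where r: "r \<in> {0<..<s}" and 2: "\<psi> s - \<psi> 0 = f'' (x + t *\<^sub>R h + r *\<^sub>R k) (s *\<^sub>R k) h"
    using mvt_simple[OF s, of \<psi> "\<lambda>r d. f'' (x + t *\<^sub>R h + r *\<^sub>R k) (d *\<^sub>R k) h"] by auto
  show thesis
  proof (rule that)
    have "norm (t *\<^sub>R h + r *\<^sub>R k) \<le> t * norm h + r * norm k"
      using norm_triangle_ineq[of "t *\<^sub>R h" "r *\<^sub>R k"] t r by simp
    also have "\<dots> \<le> s * norm h + s * norm k"
      using t r by (intro add_mono mult_right_mono) auto
    finally show "norm (x + t *\<^sub>R h + r *\<^sub>R k - x) \<le> s * (norm h + norm k)"
      by (simp add: algebra_simps)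
    show "f (x + s *\<^sub>R h + s *\<^sub>R k) - f (x + s *\<^sub>R h) - f (x + s *\<^sub>R k) + f x =
        s\<^sup>2 * f'' (x + t *\<^sub>R h + r *\<^sub>R k) k h"
      using 1 2 by (simp add: \<phi>_def \<psi>_def blinfun.scaleR_right blinfun.scaleR_left power2_eq_square
          flip: right_diff_distrib)
  qed
qed

text \<open>The second difference is symmetric in \<open>h\<close> and \<open>k\<close>, so its two
  mean value forms agree, with the arguments of \<open>f''\<close> exchanged; continuity carries
  this to \<open>x\<close>.\<close>

lemma second_derivative_symmetric:
  fixes f :: "'a::real_normed_vector \<Rightarrow> real"
    and f' :: "'a \<Rightarrow> 'a \<Rightarrow>\<^sub>L real" and f'' :: "'a \<Rightarrow> 'a \<Rightarrow>\<^sub>L 'a \<Rightarrow>\<^sub>L real"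
  assumes f': "\<And>x. (f has_derivative blinfun_apply (f' x)) (at x)"
    and f'': "\<And>x. (f' has_derivative blinfun_apply (f'' x)) (at x)"
    and cont: "continuous_on UNIV f''"
  shows "f'' x h k = f'' x k h"
proof (rule ccontr)
  assume ne: "f'' x h k \<noteq> f'' x k h"
  \<comment> \<open>Half the gap: values less than \<open>e\<close> away from the two unequal
    numbers cannot coincide.\<close>
  define e where "e = \<bar>f'' x h k - f'' x k h\<bar> / 2"
  have e: "e > 0" using ne by (simp add: e_def)
  have close: "\<exists>d>0. \<forall>y. norm (y - x) < d \<longrightarrow> \<bar>f'' y a b - f'' x a b\<bar> < e" for a b
  proof -
    have "continuous_on UNIV (\<lambda>y. f'' y a b)"
      by (intro continuous_intros cont)
    then show ?thesis
      using e by (auto simp: continuous_on_iff dist_norm)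
  qed
  obtain d1 d2 where d: "d1 > 0" "d2 > 0"
    and 1: "\<And>y. norm (y - x) < d1 \<Longrightarrow> \<bar>f'' y h k - f'' x h k\<bar> < e"
    and 2: "\<And>y. norm (y - x) < d2 \<Longrightarrow> \<bar>f'' y k h - f'' x k h\<bar> < e"
    using close[of h k] close[of k h] by metis
  define s where "s = min d1 d2 / (norm h + norm k + 1)"
  have s: "s > 0" using d by (auto simp: s_def intro!: divide_pos_pos add_nonneg_pos)
  have "s * (norm h + norm k) < s * (norm h + norm k + 1)" using s by simp
  also have "\<dots> = min d1 d2"
    using norm_ge_zero[of h] norm_ge_zero[of k] by (simp add: s_def add_nonneg_eq_0_iff)
  finally have small: "s * (norm h + norm k) < min d1 d2" .
  obtain y where y: "norm (y - x) \<le> s * (norm h + norm k)"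
    "f (x + s *\<^sub>R h + s *\<^sub>R k) - f (x + s *\<^sub>R h) - f (x + s *\<^sub>R k) + f x = s\<^sup>2 * f'' y k h"
    using second_difference_mean_value[OF f' f'' s] .
  obtain z where z: "norm (z - x) \<le> s * (norm k + norm h)"
    "f (x + s *\<^sub>R k + s *\<^sub>R h) - f (x + s *\<^sub>R k) - f (x + s *\<^sub>R h) + f x = s\<^sup>2 * f'' z h k"
    using second_difference_mean_value[OF f' f'' s] .
  have "s\<^sup>2 * f'' y k h = s\<^sup>2 * f'' z h k"
    using y(2) z(2) by (simp add: algebra_simps)
  then have "f'' y k h = f'' z h k" using s by simp
  moreover have "\<bar>f'' z h k - f'' x h k\<bar> < e" using z(1) small by (intro 1) (simp add: add.commute)
  moreover have "\<bar>f'' y k h - f'' x k h\<bar> < e" using y(1) small by (intro 2) simp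
  ultimately show False unfolding e_def by (simp add: abs_if split: if_splits)
qed

section \<open>Outer products and matrices of rank at most two\<close>

definition outer :: "real^1^'n \<Rightarrow> real^1^'m \<Rightarrow> real^'m^'n" where
  "outer U V = U ** transpose V"

lemma outer_nth [simp]: "outer U V $ i $ j = U $ i $ 1 * V $ j $ 1"
  by (simp add: outer_def matrix_matrix_mult_def transpose_def)

lemma bounded_bilinear_outer: "bounded_bilinear (outer :: real^1^'n \<Rightarrow> real^1^'m \<Rightarrow> _)"
  unfolding bilinear_conv_bounded_bilinear[symmetric] bilinear_def
  by (auto intro!: linearI simp: vec_eq_iff algebra_simps)

interpretation outer: bounded_bilinear "outer :: real^1^'n \<Rightarrow> real^1^'m \<Rightarrow> _"
  by (rule bounded_bilinear_outer)

lemma inner_single_column: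
  fixes X Y :: "real^1^'n"
  shows "X \<bullet> Y = (\<Sum>i\<in>UNIV. X $ i $ 1 * Y $ i $ 1)"
  by (simp add: inner_vec_def)

lemma inner_outer: "outer A B \<bullet> outer C D = (A \<bullet> C) * (B \<bullet> D)"
  unfolding inner_single_column sum_product by (simp add: inner_vec_def mult_ac)

lemma norm_outer: "norm (outer A B) = norm A * norm B"
  by (simp add: norm_eq_sqrt_inner inner_outer real_sqrt_mult)

text \<open>The range is spanned by the columns of \<open>A\<close> and \<open>C\<close>. This is
  how base points and directions are shown to be admissible for the RIP.\<close>

lemma rank_outer_add_le: "rank (outer A B + outer C D) \<le> 2"
proof -
  have "(outer A B + outer C D) *v x \<in> span {column 1 A, column 1 C}" for x
  proof -
    have "(outer A B + outer C D) *v x =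
        (\<Sum>j\<in>UNIV. B $ j $ 1 * x $ j) *\<^sub>R column 1 A + (\<Sum>j\<in>UNIV. D $ j $ 1 * x $ j) *\<^sub>R column 1 C"
      by (simp add: vec_eq_iff matrix_vector_mult_def column_def sum_distrib_right sum_distrib_left
          sum.distrib algebra_simps)
    then show ?thesis
      by (simp add: span_add span_scale span_base)
  qed
  then have "rank (outer A B + outer C D) \<le> card {column 1 A, column 1 C}"
    unfolding rank_dim_range by (intro dim_le_card) auto
  also have "\<dots> \<le> 2" by (simp add: card_insert_if)
  finally show ?thesis .
qed

text \<open>All columns are multiples of one vector \<open>a\<close>; the coefficients form the
  second factor.\<close>

lemma rank_le_1_imp_outer:
  fixes M :: "real^'m^'n"
  assumes "rank M \<le> 1"
  obtains A B where "M = outer A B"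
proof -
  obtain S where S: "columns M \<subseteq> span S" "card S = rank M" "finite S"
    using basis_exists[of "columns M"] unfolding column_rank_def
    by (metis finiteI_independent)
  obtain a where a: "columns M \<subseteq> span {a}"
  proof (cases "card S = 0")
    case True
    then show ?thesis using S that[of 0] by auto
  next
    case False
    then have "card S = 1" using S(2) assms by simp
    then show ?thesis using S(1) that by (metis card_1_singletonE)
  qed
  have "\<exists>c. column j M = c *\<^sub>R a" for j
    using a by (auto simp: columns_def span_singleton)
  then obtain b where b: "\<And>j. column j M = b j *\<^sub>R a" by metis
  have "M = outer (\<chi> i k. a $ i) (\<chi> j k. b j)"
    using b by (simp add: vec_eq_iff column_def mult.commute)
  then show thesis by (rule that)
qed

section \<open>Scalar inequalities\<close>

text \<open>For positive \<open>p\<close> and \<open>q\<close> the right-hand side is minimal at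
  \<open>t = sqrt (q / p)\<close>, with value \<open>2 * p * q\<close>. If one of them vanishes, the
  infimum 0 is approached by large or small \<open>t\<close>.\<close>

lemma le_two_mult_of_scaling:
  fixes p q c :: real
  assumes "p \<ge> 0" "q \<ge> 0" and c: "\<And>t. t > 0 \<Longrightarrow> c \<le> (p * t)\<^sup>2 + (q / t)\<^sup>2"
  shows "c \<le> 2 * p * q"
proof (rule ccontr)
  assume contra: "\<not> c \<le> 2 * p * q"
  define e where "e = c - 2 * p * q"
  have e: "e > 0" using contra by (simp add: e_def)
  consider "p > 0" "q > 0" | "p = 0" | "q = 0" using assms by linarith
  then show False
  proof cases
    case 1
    then have "c \<le> (p * sqrt (q / p))\<^sup>2 + (q / sqrt (q / p))\<^sup>2" by (intro c) simp
    also have "\<dots> = 2 * p * q"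
      using 1 by (simp add: power_mult_distrib power_divide) (simp add: power2_eq_square)
    finally show False using contra by simp
  next
    case 2
    \<comment> \<open>Large enough that \<open>(q / t)\<^sup>2 < e\<close>; the summand 1 keeps
      \<open>t\<close> positive when \<open>q = 0\<close>.\<close>
    define t where "t = (q + 1) / sqrt e"
    have "c \<le> (p * t)\<^sup>2 + (q / t)\<^sup>2" using e assms by (intro c) (simp add: t_def add_nonneg_pos)
    also have "\<dots> = (q / (q + 1))\<^sup>2 * e" using 2 e by (simp add: t_def power_divide power_mult_distrib)
    also have "\<dots> < 1 * e"
      using assms e by (intro mult_strict_right_mono) (simp_all add: power_less_one_iff)
    finally show False using 2 by (simp add: e_def)
  next
    case 3
    define t where "t = sqrt e / (p + 1)"
    have "c \<le> (p * t)\<^sup>2 + (q / t)\<^sup>2" using e assms by (intro c) (simp add: t_def add_nonneg_pos)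
    also have "\<dots> = (p / (p + 1))\<^sup>2 * e" using 3 e by (simp add: t_def power_divide power_mult_distrib)
    also have "\<dots> < 1 * e"
      using assms e by (intro mult_strict_right_mono) (simp_all add: power_less_one_iff)
    finally show False using 3 by (simp add: e_def)
  qed
qed

text \<open>
  Here \<open>N = \<parallel>E\<parallel>\<^sup>2\<close>, \<open>\<sigma> = \<parallel>M\<parallel>\<close>, \<open>s = \<parallel>M*\<parallel>\<close>, \<open>t\<close> is the norm of the part of \<open>M*\<close> normal to
  the tangent space at \<open>M\<close>, and \<open>-\<gamma>\<close> is the slope of the gradient in the direction of that part.
  The inequalities are affine in \<open>t\<close> and least restrictive at \<open>t = s\<close>; completing the square in \<open>s\<close>
  then gives \<open>(1 - \<delta>\<^sup>2) \<sigma> \<le> \<delta> \<gamma>\<close>, which needs \<open>\<delta> \<ge> 1/2\<close>.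
\<close>

lemma spurious_scalar_bound:
  fixes \<delta> \<sigma> s t \<gamma> N :: real
  assumes \<delta>: "0 \<le> \<delta>" "\<delta> < 1/2" and \<sigma>: "0 \<le> \<sigma>" and t: "0 \<le> t" "t \<le> s"
    and \<gamma>: "\<gamma> \<le> (1 + \<delta>) * \<sigma>"
    and N: "\<sigma>\<^sup>2 + s\<^sup>2 - 2 * \<sigma> * (s - t) \<le> N" "N > 0"
    and le: "(1 - \<delta>\<^sup>2) * N \<le> 2 * \<gamma> * t - \<gamma>\<^sup>2"
  shows False
proof -
  define D where "D = 1 - \<delta>\<^sup>2"
  have "\<delta>\<^sup>2 < 1" using \<delta> by (simp add: power_less_one_iff)
  then have D: "D > 0" by (simp add: D_def)
  have "0 < D * N" using D N by simp
  also have "D * N \<le> 2 * \<gamma> * t - \<gamma>\<^sup>2" using le by (simp add: D_def)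
  finally have pos: "0 < 2 * \<gamma> * t - \<gamma>\<^sup>2" .
  have "0 < \<gamma> * t" using pos zero_le_power2[of \<gamma>] by linarith
  then have \<gamma>0: "\<gamma> > 0" using t by (auto simp: zero_less_mult_iff)
  have t0: "t > 0" using \<open>0 < \<gamma> * t\<close> \<gamma>0 by (simp add: zero_less_mult_iff)
  have "D * (\<sigma>\<^sup>2 + s\<^sup>2 - 2 * \<sigma> * (s - t)) \<le> D * N" using D N by simp
  with le have a: "D * (\<sigma> - s)\<^sup>2 + \<gamma>\<^sup>2 \<le> 2 * (\<gamma> - D * \<sigma>) * t"
    by (simp add: D_def power2_eq_square algebra_simps)
  have "0 < D * (\<sigma> - s)\<^sup>2 + \<gamma>\<^sup>2" using D \<gamma>0 by (simp add: add_nonneg_pos)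
  with a have "0 < 2 * (\<gamma> - D * \<sigma>) * t" by linarith
  with t0 have "\<gamma> - D * \<sigma> > 0" by (simp add: zero_less_mult_iff)
  then have "2 * (\<gamma> - D * \<sigma>) * t \<le> 2 * (\<gamma> - D * \<sigma>) * s" using t by simp
  with a have "D * (\<sigma>\<^sup>2 + s\<^sup>2) \<le> 2 * \<gamma> * s - \<gamma>\<^sup>2" by (simp add: power2_eq_square algebra_simps)
  then have "D * (D * (\<sigma>\<^sup>2 + s\<^sup>2)) \<le> D * (2 * \<gamma> * s - \<gamma>\<^sup>2)" using D by simp
  moreover have "0 \<le> (D * s - \<gamma>)\<^sup>2" by simp
  ultimately have "D\<^sup>2 * \<sigma>\<^sup>2 \<le> \<gamma>\<^sup>2 - D * \<gamma>\<^sup>2" by (simp add: power2_eq_square algebra_simps)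
  also have "\<dots> = (\<delta> * \<gamma>)\<^sup>2" by (simp add: D_def power2_eq_square algebra_simps)
  finally have "(D * \<sigma>)\<^sup>2 \<le> (\<delta> * \<gamma>)\<^sup>2" by (simp add: power_mult_distrib)
  then have "D * \<sigma> \<le> \<delta> * \<gamma>" using \<delta> \<gamma>0 by (auto intro: power2_le_imp_le)
  also have "\<dots> \<le> \<delta> * ((1 + \<delta>) * \<sigma>)" using \<gamma> \<delta> by (intro mult_left_mono)
  \<comment> \<open>The threshold 1/2 comes from \<open>D = (1 - \<delta>) * (1 + \<delta>)\<close>.
    The contradiction uses that \<open>\<sigma>\<close> is positive, since
    \<open>0 < \<gamma> \<le> (1 + \<delta>) * \<sigma>\<close>.\<close>
  finally have "(1 + \<delta>) * \<sigma> * (1 - 2 * \<delta>) \<le> 0"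
    by (simp add: D_def power2_eq_square algebra_simps)
  moreover have "(1 + \<delta>) * \<sigma> * (1 - 2 * \<delta>) > 0" using \<delta> \<gamma>0 \<gamma> by simp
  ultimately show False by simp
qed

section \<open>The polarized RIP bound and its consequence for rank-one matrices\<close>

text \<open>Polarization after normalizing \<open>h\<close> and \<open>k\<close>, which makes the
  error a product of norms. The bounds are assumed only on the span of \<open>h\<close> and
  \<open>k\<close> because the RIP holds only for low rank.\<close>

lemma near_identity_form_polarized:
  fixes b :: "'a::real_inner \<Rightarrow> 'a \<Rightarrow> real"
  assumes b: "bounded_bilinear b" and sym: "\<And>h k. b h k = b k h"
    and bounds: "\<And>s t. let K = s *\<^sub>R h + t *\<^sub>R k in
      (1 - \<delta>) * (norm K)\<^sup>2 \<le> b K K \<and> b K K \<le> (1 + \<delta>) * (norm K)\<^sup>2"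
  shows "\<bar>b h k - h \<bullet> k\<bar> \<le> \<delta> * norm h * norm k"
proof (cases "h = 0 \<or> k = 0")
  case True
  then show ?thesis
    using bounded_bilinear.zero_left[OF b] bounded_bilinear.zero_right[OF b] by auto
next
  case False
  interpret b: bounded_bilinear b by (rule b)
  define p q where "p = h /\<^sub>R norm h" and "q = k /\<^sub>R norm k"
  have pq: "norm p = 1" "norm q = 1" using False by (simp_all add: p_def q_def)
  have *: "(1 - \<delta>) * (norm (p + r *\<^sub>R q))\<^sup>2 \<le> b (p + r *\<^sub>R q) (p + r *\<^sub>R q)"
    "b (p + r *\<^sub>R q) (p + r *\<^sub>R q) \<le> (1 + \<delta>) * (norm (p + r *\<^sub>R q))\<^sup>2" for r
    using bounds[of "inverse (norm h)" "r * inverse (norm k)"] by (simp_all add: p_def q_def Let_def)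
  have n: "(norm (p + r *\<^sub>R q))\<^sup>2 = 1 + r\<^sup>2 + 2 * r * (p \<bullet> q)" for r
    using pq unfolding power2_norm_eq_inner
    by (simp add: inner_add inner_commute power2_eq_square norm_eq_1 algebra_simps)
  have e: "b (p + r *\<^sub>R q) (p + r *\<^sub>R q) = b p p + r\<^sup>2 * b q q + 2 * r * b p q" for r
    by (simp add: b.add_left b.add_right b.scaleR_left b.scaleR_right sym[of q p] power2_eq_square algebra_simps)
  \<comment> \<open>Compare the bounds at \<open>p + q\<close> and \<open>p - q\<close>; by the
    parallelogram law the errors add up to \<open>4 * \<delta>\<close>, against
    \<open>4 * b p q\<close>.\<close>
  have "\<bar>b p q - p \<bullet> q\<bar> \<le> \<delta>"
    using *[of 1] *[of "-1"] unfolding n e by (simp add: algebra_simps abs_le_iff)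
  then have "norm h * norm k * \<bar>b p q - p \<bullet> q\<bar> \<le> norm h * norm k * \<delta>"
    by (intro mult_left_mono) simp_all
  moreover have "norm h * norm k * \<bar>b p q - p \<bullet> q\<bar> = \<bar>norm h * norm k * (b p q - p \<bullet> q)\<bar>"
    by (simp add: abs_mult)
  moreover have "norm h * norm k * (b p q - p \<bullet> q) = b h k - h \<bullet> k"
    using False by (simp add: p_def q_def b.scaleR_left b.scaleR_right field_simps)
  ultimately show ?thesis by (simp add: mult_ac)
qed

text \<open>Here \<open>g\<close> is the gradient at \<open>outer U V\<close> as a functional. One
  well-chosen test matrix \<open>W\<close> in \<open>near\<close> reduces the claim to an inequality
  between norms, which \<open>spurious_scalar_bound\<close> refutes when \<open>E\<close> is
  nonzero.\<close>

lemma outer_eq_of_near_isometry: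
  fixes U A :: "real^1^'n" and V B :: "real^1^'m"
  assumes \<delta>: "0 \<le> \<delta>" "\<delta> < 1/2" and g: "linear g"
    and gU: "\<And>Y. g (outer U Y) = 0" and gV: "\<And>X. g (outer X V) = 0"
    and neg: "\<And>X Y. U \<bullet> X = 0 \<Longrightarrow> V \<bullet> Y = 0 \<Longrightarrow>
      - g (outer X Y) \<le> (1 + \<delta>) * norm U * norm V * (norm X * norm Y)"
    and near: "\<And>P Q. let E = outer U V - outer A B; W = outer U P + outer A Q in
      \<bar>g W - E \<bullet> W\<bar> \<le> \<delta> * norm E * norm W"
  shows "outer U V = outer A B"
proof (rule ccontr)
  assume ne: "outer U V \<noteq> outer A B"
  interpret g: linear g by (rule g)
  \<comment> \<open>Projection coefficients, so that \<open>X\<close> and \<open>Y\<close> are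
    orthogonal to \<open>U\<close> and \<open>V\<close>. If \<open>U = 0\<close>, division by zero
    gives \<open>\<kappa> = 0\<close> and \<open>X = A\<close>, which is still orthogonal; likewise
    for \<open>V\<close>.\<close>
  define \<kappa> \<nu> where "\<kappa> = (U \<bullet> A) / (U \<bullet> U)" and "\<nu> = (V \<bullet> B) / (V \<bullet> V)"
  define X Y where "X = A - \<kappa> *\<^sub>R U" and "Y = B - \<nu> *\<^sub>R V"
  have ortho: "U \<bullet> X = 0" "V \<bullet> Y = 0"
    by (auto simp: X_def Y_def \<kappa>_def \<nu>_def inner_diff_right)
  have AB: "A = X + \<kappa> *\<^sub>R U" "B = Y + \<nu> *\<^sub>R V" by (simp_all add: X_def Y_def)
  have nA: "(norm A)\<^sup>2 = (norm X)\<^sup>2 + \<kappa>\<^sup>2 * (norm U)\<^sup>2" "(norm B)\<^sup>2 = (norm Y)\<^sup>2 + \<nu>\<^sup>2 * (norm V)\<^sup>2"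
    using ortho unfolding power2_norm_eq_inner AB
    by (simp_all add: inner_add inner_commute power2_eq_square algebra_simps)
  define \<sigma> s t h where "\<sigma> = norm U * norm V" and "s = norm A * norm B"
    and "t = norm X * norm Y" and "h = g (outer X Y)"
  define E where "E = outer U V - outer A B"
  \<comment> \<open>For \<open>t = 0\<close> the convention for division by zero makes
    \<open>c\<close> and \<open>\<gamma>\<close> zero, in agreement with \<open>h0\<close>
    below.\<close>
  define c where "c = h / t\<^sup>2"
  define \<gamma> where "\<gamma> = - h / t"
  have gAB: "g (outer A B) = h"
    by (simp add: AB h_def outer.add_left outer.add_right outer.scaleR_left outer.scaleR_right
        g.add g.scale gU gV)
  have h0: "h = 0" if "t = 0"
    using that by (auto simp: t_def h_def outer.zero_left outer.zero_right g.zero)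
  \<comment> \<open>\<open>W = G - E\<close> for the projection \<open>G = c XY\<^sup>T\<close> of the gradient to \<open>span(U, X) \<otimes> span(V, Y)\<close>; hence
    \<open>g W - E \<bullet> W = \<parallel>W\<parallel>\<^sup>2\<close>. All combinations of \<open>E\<close> and \<open>W\<close> have rank at most \<open>2\<close>.\<close>
  define W where "W = c *\<^sub>R outer X Y - E"
  \<comment> \<open>Substituting \<open>X = A - \<kappa> *\<^sub>R U\<close> puts \<open>W\<close>
    into the shape that \<open>near\<close> accepts.\<close>
  have W_eq: "W = outer U ((- \<kappa> * c) *\<^sub>R Y - V) + outer A (c *\<^sub>R Y + B)"
    by (simp add: W_def E_def X_def outer.diff_left outer.diff_right outer.add_right outer.scaleR_left
        outer.scaleR_right outer.minus_right scaleR_right_diff_distrib mult.commute)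
  have EXY: "E \<bullet> outer X Y = - t\<^sup>2"
    using ortho by (simp add: E_def inner_diff_left inner_outer AB inner_add_left t_def
        power_mult_distrib power2_norm_eq_inner)
  have gE: "g E = - h" by (simp add: E_def g.diff gAB gU)
  have ct: "c * t\<^sup>2 = h" using h0 by (auto simp: c_def)
  have gW: "g W = c * h + h"
    by (simp add: W_def g.diff g.scale gE h_def[symmetric])
  have EW: "E \<bullet> W = - h - (norm E)\<^sup>2"
    using ct by (simp add: W_def inner_diff_right EXY power2_norm_eq_inner)
  have "(norm W)\<^sup>2 = c\<^sup>2 * (outer X Y \<bullet> outer X Y) - 2 * c * (E \<bullet> outer X Y) + (norm E)\<^sup>2"
    unfolding power2_norm_eq_inner W_def
    by (simp add: inner_diff inner_commute power2_eq_square algebra_simps)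
  also have "outer X Y \<bullet> outer X Y = t\<^sup>2"
    by (simp add: inner_outer t_def power_mult_distrib power2_norm_eq_inner)
  finally have nW: "(norm W)\<^sup>2 = c * h + 2 * h + (norm E)\<^sup>2"
    using ct EXY by (simp add: power2_eq_square algebra_simps)
  have "(norm W)\<^sup>2 \<le> \<delta> * norm E * norm W"
    using near[of "(- \<kappa> * c) *\<^sub>R Y - V" "c *\<^sub>R Y + B"]
    unfolding W_eq[symmetric] E_def[symmetric] Let_def by (simp add: gW EW nW)
  then have "norm W \<le> \<delta> * norm E"
    using \<delta> mult_right_le_imp_le[of "norm W" "norm W" "\<delta> * norm E"]
    by (cases "W = 0") (auto simp: power2_eq_square)
  then have "(norm W)\<^sup>2 \<le> (\<delta> * norm E)\<^sup>2" by (intro power_mono) auto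
  moreover have "c * h = \<gamma>\<^sup>2" "2 * h = - 2 * \<gamma> * t"
    using h0 by (auto simp: c_def \<gamma>_def power2_eq_square)
  ultimately have le: "(1 - \<delta>\<^sup>2) * (norm E)\<^sup>2 \<le> 2 * \<gamma> * t - \<gamma>\<^sup>2"
    unfolding nW by (simp add: power_mult_distrib algebra_simps)
  have t: "0 \<le> t" "0 \<le> \<sigma>" by (simp_all add: t_def \<sigma>_def)
  have nXA: "norm X \<le> norm A" "norm Y \<le> norm B"
    by (rule power2_le_imp_le; simp add: nA)+
  then have ts: "t \<le> s" unfolding t_def s_def by (intro mult_mono) auto
  have "- h \<le> (1 + \<delta>) * \<sigma> * t"
    using neg[OF ortho] by (simp add: h_def \<sigma>_def t_def mult_ac)
  then have \<gamma>: "\<gamma> \<le> (1 + \<delta>) * \<sigma>"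
  proof (cases "t = 0")
    case True
    then show ?thesis using \<delta> t by (simp add: \<gamma>_def)
  next
    case False
    then show ?thesis using \<open>- h \<le> (1 + \<delta>) * \<sigma> * t\<close> t by (simp add: \<gamma>_def field_simps)
  qed
  \<comment> \<open>For the lower bound on \<open>norm E\<close>: the overlap of
    \<open>outer U V\<close> and \<open>outer A B\<close> is at most
    \<open>\<sigma> * (s - t)\<close>, by the identity \<open>(a\<^sup>2 - x\<^sup>2) * (b\<^sup>2 -
    y\<^sup>2) = (a * b - x * y)\<^sup>2 - (a * y - b * x)\<^sup>2\<close>.\<close>
  have "(\<kappa> * norm U * (\<nu> * norm V))\<^sup>2 = ((norm A)\<^sup>2 - (norm X)\<^sup>2) * ((norm B)\<^sup>2 - (norm Y)\<^sup>2)"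
    by (simp add: nA power_mult_distrib mult_ac)
  also have "\<dots> = (s - t)\<^sup>2 - (norm A * norm Y - norm B * norm X)\<^sup>2"
    by (simp add: s_def t_def power2_eq_square algebra_simps)
  also have "\<dots> \<le> (s - t)\<^sup>2" by simp
  finally have "\<kappa> * norm U * (\<nu> * norm V) \<le> s - t"
    using ts by (auto intro: power2_le_imp_le)
  then have "\<sigma> * (\<kappa> * norm U * (\<nu> * norm V)) \<le> \<sigma> * (s - t)"
    using t by (intro mult_left_mono)
  moreover have "outer U V \<bullet> outer A B = \<sigma> * (\<kappa> * norm U * (\<nu> * norm V))"
    using ortho by (simp add: inner_outer AB inner_add_right \<sigma>_def dot_square_norm power2_eq_square)
  moreover have "(norm E)\<^sup>2 = (norm (outer U V))\<^sup>2 + (norm (outer A B))\<^sup>2 - 2 * (outer U V \<bullet> outer A B)"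
    unfolding E_def power2_norm_eq_inner by (simp add: inner_diff inner_commute)
  ultimately have N: "\<sigma>\<^sup>2 + s\<^sup>2 - 2 * \<sigma> * (s - t) \<le> (norm E)\<^sup>2"
    by (simp add: norm_outer \<sigma>_def s_def)
  have "(norm E)\<^sup>2 > 0" using ne by (simp add: E_def)
  from spurious_scalar_bound[OF \<delta> t(2) t(1) ts \<gamma> N this le] show False .
qed

section \<open>The objectives for single columns and their derivatives\<close>

lemma gram_single_column:
  fixes X :: "real^1^'n"
  shows "(transpose X ** X) $ 1 $ 1 = X \<bullet> X"
  by (simp add: matrix_matrix_mult_def transpose_def inner_vec_def)

lemma norm_gram_diff:
  fixes U :: "real^1^'n" and V :: "real^1^'m"
  shows "(norm (transpose U ** U - transpose V ** V))\<^sup>2 = (U \<bullet> U - V \<bullet> V)\<^sup>2"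
proof -
  have "(norm Z)\<^sup>2 = (Z $ 1 $ 1)\<^sup>2" for Z :: "real^1^1"
    unfolding power2_norm_eq_inner by (simp add: inner_vec_def power2_eq_square)
  then show ?thesis by (simp add: gram_single_column)
qed

lemma regularized_objective_eq:
  "regularized_objective \<mu> f =
    (\<lambda>z :: (real^1^'n) \<times> (real^1^'m). f (outer (fst z) (snd z)) +
      \<mu> / 4 * (fst z \<bullet> fst z - snd z \<bullet> snd z)\<^sup>2)"
  by (auto simp: regularized_objective_def outer_def norm_gram_diff fun_eq_iff)

text \<open>Allows both problems to be treated at once, for \<open>\<mu> \<ge> 0\<close>.\<close>

lemma factorized_objective_eq: "factorized_objective f = regularized_objective 0 f"
  by (auto simp: regularized_objective_def factorized_objective_def)

text \<open>Moving \<open>(U, V)\<close> by \<open>e\<close> times \<open>(X, Y)\<close> changes the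
  product by \<open>e *\<^sub>R (outer U Y + outer X V) + e\<^sup>2 *\<^sub>R outer X Y\<close>. The
  quadratic part is the source of the gradient term in the Hessian.\<close>

lemma regularized_second_order:
  fixes f :: "real^'m^'n \<Rightarrow> real" and U :: "real^1^'n" and V :: "real^1^'m"
  assumes f': "\<And>x. (f has_derivative blinfun_apply (f' x)) (at x)"
    and f'': "\<And>x. (f' has_derivative blinfun_apply (f'' x)) (at x)"
    and crit: "second_order_critical_point (regularized_objective \<mu> f) (U, V)"
  shows "f' (outer U V) (outer U Y + outer X V) + \<mu> * (U \<bullet> U - V \<bullet> V) * (U \<bullet> X - V \<bullet> Y) = 0"
    and "0 \<le> f'' (outer U V) (outer U Y + outer X V) (outer U Y + outer X V)
      + 2 * f' (outer U V) (outer X Y)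
      + \<mu> * ((U \<bullet> U - V \<bullet> V) * (X \<bullet> X - Y \<bullet> Y) + 2 * (U \<bullet> X - V \<bullet> Y)\<^sup>2)"
proof -
  define F :: "(real^1^'n) \<times> (real^1^'m) \<Rightarrow> real" where "F = regularized_objective \<mu> f"
  define D where "D z h = f' (outer (fst z) (snd z)) (outer (fst z) (snd h) + outer (fst h) (snd z)) +
    \<mu> * (fst z \<bullet> fst z - snd z \<bullet> snd z) * (fst z \<bullet> fst h - snd z \<bullet> snd h)"
    for z h :: "(real^1^'n) \<times> (real^1^'m)"
  have outer': "((\<lambda>z. outer (fst z) (snd z)) has_derivative
      (\<lambda>h. outer (fst z) (snd h) + outer (fst h) (snd z))) (at z)"
    for z :: "(real^1^'n) \<times> (real^1^'m)"
    by (rule outer.FDERIV[OF has_derivative_fst[OF has_derivative_ident] has_derivative_snd[OF has_derivative_ident]])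
  have F': "(F has_derivative D z) (at z)" for z
    unfolding F_def regularized_objective_eq D_def
    by (rule has_derivative_eq_rhs, rule has_derivative_add,
        rule has_derivative_compose[OF outer' f'], (rule derivative_intros)+)
       (auto simp: fun_eq_iff inner_commute algebra_simps power2_eq_square)
  then have FD: "frechet_derivative F (at z) = D z" for z
    by (metis frechet_derivative_at)
  have "D (U, V) h = 0" for h
  proof -
    have "(F has_derivative (\<lambda>h. 0)) (at (U, V))"
      using crit by (simp add: second_order_critical_point_def F_def gderiv_def)
    from has_derivative_unique[OF F' this] show ?thesis by simp
  qed
  from this[of "(X, Y)"]
  show "f' (outer U V) (outer U Y + outer X V) + \<mu> * (U \<bullet> U - V \<bullet> V) * (U \<bullet> X - V \<bullet> Y) = 0"
    by (simp add: D_def)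
  have D': "((\<lambda>z. D z (X, Y)) has_derivative
      (\<lambda>k. f' (outer U V) (outer (fst k) Y + outer X (snd k))
        + f'' (outer U V) (outer U (snd k) + outer (fst k) V) (outer U Y + outer X V)
        + (\<mu> * (U \<bullet> U - V \<bullet> V) * (fst k \<bullet> X - snd k \<bullet> Y)
        + \<mu> * (2 * (U \<bullet> fst k) - 2 * (V \<bullet> snd k)) * (U \<bullet> X - V \<bullet> Y)))) (at (U, V))"
  proof -
    have "((\<lambda>z. f' (outer (fst z) (snd z)) (outer (fst z) Y + outer X (snd z))) has_derivative
      (\<lambda>k. f' (outer U V) (outer (fst k) Y + outer X (snd k))
        + f'' (outer U V) (outer U (snd k) + outer (fst k) V) (outer U Y + outer X V))) (at (U, V))"
      by (rule has_derivative_eq_rhs, rule blinfun.FDERIV, rule has_derivative_compose[OF outer' f''],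
          rule has_derivative_add,
          rule bounded_linear.has_derivative[OF outer.bounded_linear_left has_derivative_fst[OF has_derivative_ident]],
          rule bounded_linear.has_derivative[OF outer.bounded_linear_right has_derivative_snd[OF has_derivative_ident]])
         simp
    moreover have "((\<lambda>z. \<mu> * (fst z \<bullet> fst z - snd z \<bullet> snd z) * (fst z \<bullet> X - snd z \<bullet> Y)) has_derivative
      (\<lambda>k. \<mu> * (U \<bullet> U - V \<bullet> V) * (fst k \<bullet> X - snd k \<bullet> Y)
        + \<mu> * (2 * (U \<bullet> fst k) - 2 * (V \<bullet> snd k)) * (U \<bullet> X - V \<bullet> Y))) (at (U, V))"
      by (rule has_derivative_eq_rhs, (rule derivative_intros)+)
         (auto simp: fun_eq_iff inner_commute algebra_simps)
    ultimately show ?thesis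
      unfolding D_def by (auto intro: has_derivative_add)
  qed
  have "0 \<le> hessian F (U, V) (X, Y) (X, Y)"
    using crit by (simp add: second_order_critical_point_def F_def)
  also have "hessian F (U, V) (X, Y) (X, Y) =
      f' (outer U V) (outer X Y + outer X Y)
        + f'' (outer U V) (outer U Y + outer X V) (outer U Y + outer X V)
        + (\<mu> * (U \<bullet> U - V \<bullet> V) * (X \<bullet> X - Y \<bullet> Y)
        + \<mu> * (2 * (U \<bullet> X) - 2 * (V \<bullet> Y)) * (U \<bullet> X - V \<bullet> Y))"
    unfolding hessian_def FD using fun_cong[OF frechet_derivative_at[OF D'], of "(X, Y)"] by simp
  finally show "0 \<le> f'' (outer U V) (outer U Y + outer X V) (outer U Y + outer X V)
      + 2 * f' (outer U V) (outer X Y)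
      + \<mu> * ((U \<bullet> U - V \<bullet> V) * (X \<bullet> X - Y \<bullet> Y) + 2 * (U \<bullet> X - V \<bullet> Y)\<^sup>2)"
    unfolding blinfun.add_right[of _ "outer X Y" "outer X Y"]
    by (simp add: power2_eq_square algebra_simps)
qed

section \<open>Global optimality of second-order critical points\<close>

text \<open>With \<open>k\<close> fixed, the derivative is a scalar function along the segment, so
  one intermediate point, depending on \<open>k\<close>, replaces an integral of the
  Hessian.\<close>

lemma derivative_mean_value:
  fixes f' :: "'a::real_normed_vector \<Rightarrow> 'a \<Rightarrow>\<^sub>L real" and f'' :: "'a \<Rightarrow> 'a \<Rightarrow>\<^sub>L 'a \<Rightarrow>\<^sub>L real"
  assumes f'': "\<And>x. (f' has_derivative blinfun_apply (f'' x)) (at x)"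
  obtains r where "0 < r" "r < 1" "f' (x + h) k - f' x k = f'' (x + r *\<^sub>R h) h k"
proof -
  have "((\<lambda>r. f' (x + r *\<^sub>R h) k) has_derivative (\<lambda>d. f'' (x + r *\<^sub>R h) (d *\<^sub>R h) k)) (at r within {0..1})" for r
    by (rule bounded_linear.has_derivative[OF blinfun.bounded_linear_left], rule has_derivative_compose[OF _ f''])
       (auto intro!: derivative_eq_intros)
  then obtain r where r: "r \<in> {0<..<1}" and "f' (x + 1 *\<^sub>R h) k - f' (x + 0 *\<^sub>R h) k = f'' (x + r *\<^sub>R h) ((1 - 0) *\<^sub>R h) k"
    using mvt_simple[of 0 1 "\<lambda>r. f' (x + r *\<^sub>R h) k" "\<lambda>r d. f'' (x + r *\<^sub>R h) (d *\<^sub>R h) k"] by auto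
  then show thesis by (intro that[of r]) simp_all
qed

theorem corollary1:
  fixes f :: "real^'m^'n \<Rightarrow> real"
    and \<delta> :: real
    and Mstar :: "real^'m^'n"
  assumes "twice_continuously_differentiable f"
    and "first_order_critical_point f Mstar"
    and "rank Mstar \<le> 1"
    and "RIP 2 2 \<delta> f"
    and "\<delta> < 1/2"
  shows "(\<nexists>x :: (real^1^'n) \<times> (real^1^'m).
            spurious_second_order_critical_point (factorized_objective f) x) \<and>
         (\<forall>\<mu>>0. \<nexists>x :: (real^1^'n) \<times> (real^1^'m).
            spurious_second_order_critical_point (regularized_objective \<mu> f) x)"
proof -
  obtain f' :: "real^'m^'n \<Rightarrow> (real^'m^'n) \<Rightarrow>\<^sub>L real"
    and f'' :: "real^'m^'n \<Rightarrow> (real^'m^'n) \<Rightarrow>\<^sub>L (real^'m^'n) \<Rightarrow>\<^sub>L real"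
    where f': "\<And>x. (f has_derivative blinfun_apply (f' x)) (at x)"
      and f'': "\<And>x. (f' has_derivative blinfun_apply (f'' x)) (at x)"
      and cont: "continuous_on UNIV f''"
    using assms(1) unfolding twice_continuously_differentiable_def by metis
  obtain A B where Mstar: "Mstar = outer A B"
    using rank_le_1_imp_outer[OF assms(3)] .
  have crit: "f' (outer A B) h = 0" for h
  proof -
    have "(f has_derivative (\<lambda>h. 0)) (at (outer A B))"
      using assms(2) by (simp add: first_order_critical_point_def gderiv_def Mstar)
    from has_derivative_unique[OF f' this] show ?thesis by simp
  qed
  have \<delta>: "0 \<le> \<delta>" "\<delta> < 1/2" using assms(4,5) by (auto simp: RIP_def)
  have rip: "(1 - \<delta>) * (norm K)\<^sup>2 \<le> f'' M K K" "f'' M K K \<le> (1 + \<delta>) * (norm K)\<^sup>2"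
    if "M = outer P Q + outer R S" "K = outer P' Q' + outer R' S'" for M K P Q R S P' Q' R' S'
  proof -
    have "rank M \<le> 2" "rank K \<le> 2"
      unfolding that by (rule rank_outer_add_le)+
    then show "(1 - \<delta>) * (norm K)\<^sup>2 \<le> f'' M K K" "f'' M K K \<le> (1 + \<delta>) * (norm K)\<^sup>2"
      using assms(4) by (auto simp: RIP_def simp flip: hessian_eq_second_derivative[OF f' f''])
  qed
  \<comment> \<open>Segments starting at \<open>outer A B\<close> stay within sums of two outer
    products, so the RIP applies along them.\<close>
  have segment: "outer A B + r *\<^sub>R (outer P Q - outer A B) = outer P (r *\<^sub>R Q) + outer A ((1 - r) *\<^sub>R B)"
    for r P Q
    by (simp add: outer.scaleR_right outer.diff_right algebra_simps)
  \<comment> \<open>Along the segment the first derivative starts at 0 and the Hessian is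
    nonnegative on \<open>E\<close> by the lower RIP bound; two applications of the mean value
    theorem suffice.\<close>
  have min: "f (outer A B) \<le> f (outer P Q)" for P Q
  proof -
    define E where "E = outer P Q - outer A B"
    have "((\<lambda>r. f (outer A B + r *\<^sub>R E)) has_derivative (\<lambda>d. f' (outer A B + r *\<^sub>R E) (d *\<^sub>R E)))
        (at r within {0..1})" for r
      by (rule has_derivative_compose[OF _ f']) (auto intro!: derivative_eq_intros)
    then obtain r where r: "r \<in> {0<..<1}"
      and 1: "f (outer A B + 1 *\<^sub>R E) - f (outer A B + 0 *\<^sub>R E) = f' (outer A B + r *\<^sub>R E) ((1 - 0) *\<^sub>R E)"
      using mvt_simple[of 0 1 "\<lambda>r. f (outer A B + r *\<^sub>R E)" "\<lambda>r d. f' (outer A B + r *\<^sub>R E) (d *\<^sub>R E)"] by auto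
    obtain q where q: "f' (outer A B + r *\<^sub>R E) E - f' (outer A B) E = f'' (outer A B + q *\<^sub>R r *\<^sub>R E) (r *\<^sub>R E) E"
      using derivative_mean_value[OF f''] .
    have "(1 - \<delta>) * (norm E)\<^sup>2 \<le> f'' (outer A B + (q * r) *\<^sub>R E) E E"
      by (rule rip[OF segment[of "q * r" P Q, folded E_def], of _ P Q A "- B"])
         (simp add: E_def outer.minus_right)
    moreover have "0 \<le> (1 - \<delta>) * (norm E)\<^sup>2" using \<delta> by simp
    ultimately have "0 \<le> r * f'' (outer A B + (q * r) *\<^sub>R E) E E" using r by simp
    with 1 q show ?thesis by (simp add: crit E_def blinfun.scaleR_right blinfun.scaleR_left)
  qed
  have "is_arg_min (regularized_objective \<mu> f) (\<lambda>_. True) (U, V)"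
    if \<mu>: "\<mu> \<ge> 0" and so: "second_order_critical_point (regularized_objective \<mu> f) (U, V)"
    for \<mu> and U :: "real^1^'n" and V :: "real^1^'m"
  proof -
    note first = regularized_second_order(1)[OF f' f'' so]
      and second = regularized_second_order(2)[OF f' f'' so]
    define g where "g = blinfun_apply (f' (outer U V))"
    have g: "linear g" unfolding g_def by (rule linearI) (simp_all add: blinfun.add_right blinfun.scaleR_right)
    \<comment> \<open>Subtract the first-order conditions in the directions \<open>(U, 0)\<close>
      and \<open>(0, V)\<close>.\<close>
    have balanced: "\<mu> * (U \<bullet> U - V \<bullet> V) = 0"
    proof -
      define m where "m = \<mu> * (U \<bullet> U - V \<bullet> V)"
      have "g (outer U V) + m * (U \<bullet> U) = 0" "g (outer U V) - m * (V \<bullet> V) = 0"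
        using first[of 0 U] first[of V 0] by (simp_all add: g_def m_def outer.zero_left outer.zero_right)
      then have "m * (U \<bullet> U + V \<bullet> V) = 0" by (simp add: distrib_left)
      moreover have "m = 0" if "U \<bullet> U + V \<bullet> V = 0"
        using that by (simp add: m_def add_nonneg_eq_0_iff)
      ultimately show ?thesis unfolding m_def[symmetric] by auto
    qed
    have gU: "g (outer U Y) = 0" for Y
      using first[of Y 0] balanced by (simp add: g_def outer.zero_left outer.zero_right)
    have gV: "g (outer X V) = 0" for X
      using first[of 0 X] balanced by (simp add: g_def outer.zero_left outer.zero_right)
    have neg: "- g (outer X Y) \<le> (1 + \<delta>) * norm U * norm V * (norm X * norm Y)"
      if ortho: "U \<bullet> X = 0" "V \<bullet> Y = 0" for X Y
    proof -
      \<comment> \<open>Test the Hessian with \<open>(X /\<^sub>R t, t *\<^sub>R Y)\<close>: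
        \<open>outer X Y\<close> is unchanged, the regularizer contributes nothing, and the two
        orthogonal parts of \<open>K\<close> scale inversely. Optimizing over \<open>t\<close> gives
        the product of norms.\<close>
      have "- 2 * g (outer X Y) / (1 + \<delta>) \<le> 2 * (norm U * norm Y) * (norm X * norm V)"
      proof (rule le_two_mult_of_scaling)
        fix t :: real assume t: "t > 0"
        define K where "K = outer U (t *\<^sub>R Y) + outer (X /\<^sub>R t) V"
        have "0 \<le> f'' (outer U V) K K + 2 * g (outer (X /\<^sub>R t) (t *\<^sub>R Y))"
          using second[of "t *\<^sub>R Y" "X /\<^sub>R t"] ortho balanced unfolding K_def g_def
          by (simp add: distrib_left flip: mult.assoc)
        also have "outer (X /\<^sub>R t) (t *\<^sub>R Y) = outer X Y"
          using t by (simp add: outer.scaleR_left outer.scaleR_right)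
        also have "f'' (outer U V) K K \<le> (1 + \<delta>) * (norm K)\<^sup>2"
          by (rule rip[of _ U V 0 0, OF _ K_def]) (simp add: outer.zero_left)
        also have "(norm K)\<^sup>2 = (norm U * norm Y * t)\<^sup>2 + (norm X * norm V / t)\<^sup>2"
        proof -
          have "outer U (t *\<^sub>R Y) \<bullet> outer (X /\<^sub>R t) V = 0"
            using ortho by (simp add: inner_outer)
          then have "(norm K)\<^sup>2 = (norm (outer U (t *\<^sub>R Y)))\<^sup>2 + (norm (outer (X /\<^sub>R t) V))\<^sup>2"
            unfolding K_def power2_norm_eq_inner by (simp add: inner_add inner_commute)
          then show ?thesis using t by (simp add: norm_outer power_mult_distrib field_simps)
        qed
        finally show "- 2 * g (outer X Y) / (1 + \<delta>) \<le> (norm U * norm Y * t)\<^sup>2 + (norm X * norm V / t)\<^sup>2"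
          using \<delta> by (simp add: field_simps)
      qed auto
      then show ?thesis using \<delta> by (simp add: field_simps)
    qed
    have "outer U V = outer A B"
    proof (rule outer_eq_of_near_isometry[OF \<delta> g gU gV neg])
      fix P :: "real^1^'m" and Q :: "real^1^'m"
      define E W where "E = outer U V - outer A B" and "W = outer U P + outer A Q"
      obtain r where r: "f' (outer A B + E) W - f' (outer A B) W = f'' (outer A B + r *\<^sub>R E) E W"
        using derivative_mean_value[OF f''] .
      have "\<bar>f'' (outer A B + r *\<^sub>R E) E W - E \<bullet> W\<bar> \<le> \<delta> * norm E * norm W"
      proof (rule near_identity_form_polarized[where b = "\<lambda>h k. f'' (outer A B + r *\<^sub>R E) h k"])
        show "bounded_bilinear (\<lambda>h k. f'' (outer A B + r *\<^sub>R E) h k)"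
          by (rule bounded_bilinear.comp1[OF bounded_bilinear_blinfun_apply blinfun.bounded_linear_right])
        show "f'' (outer A B + r *\<^sub>R E) h k = f'' (outer A B + r *\<^sub>R E) k h" for h k
          by (rule second_derivative_symmetric[OF f' f'' cont])
        \<comment> \<open>Both \<open>E\<close> and \<open>W\<close> have their columns in the span
          of \<open>U\<close> and \<open>A\<close>, hence so do all combinations, and the RIP
          controls the whole plane they span.\<close>
        have "s *\<^sub>R E + t *\<^sub>R W = outer U (s *\<^sub>R V + t *\<^sub>R P) + outer A (t *\<^sub>R Q - s *\<^sub>R B)" for s t
          by (simp add: E_def W_def outer.add_right outer.diff_right outer.scaleR_right algebra_simps)
        from rip[OF segment[of r U V, folded E_def] this]
        show "let K = s *\<^sub>R E + t *\<^sub>R W in (1 - \<delta>) * (norm K)\<^sup>2 \<le> f'' (outer A B + r *\<^sub>R E) K K \<and>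
            f'' (outer A B + r *\<^sub>R E) K K \<le> (1 + \<delta>) * (norm K)\<^sup>2" for s t
          by (simp add: Let_def)
      qed
      with r show "let E = outer U V - outer A B; W = outer U P + outer A Q
          in \<bar>g W - E \<bullet> W\<bar> \<le> \<delta> * norm E * norm W"
        by (simp add: Let_def crit g_def flip: E_def W_def) (simp add: E_def)
    qed
    \<comment> \<open>The value at \<open>(U, V)\<close> is \<open>f (outer A B)\<close>, as
      \<open>balanced\<close> removes the penalty; elsewhere the penalty is nonnegative and
      \<open>min\<close> applies.\<close>
    then show ?thesis
      using min \<mu> balanced
      by (auto simp: is_arg_min_linorder regularized_objective_eq power2_eq_square intro!: add_increasing2)
  qed
  then show ?thesis
    unfolding factorized_objective_eq spurious_second_order_critical_point_def by fastforce
qed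

end
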